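(* Let $\mathfrak{g}$ be a semisimple Lie algebra over an algebraically closed field $\mathbb{F}$ of characteristic not $2$ or $3$, and let $(\rho,V)$ be a finite-dimensional representation of $\mathfrak{g}$ which does not contain the trivial representation as a subrepresentation. Then every linear kernel vector $\psi:\mathfrak{g}\to V$ of $(\rho,V)$ is a homomorphism of representations from the adjoint representation $(\mathrm{ad},\mathfrak{g})$ to $(\rho,V)$, i.e. for all $x,y\in\mathfrak{g}$, $$\psi([x,y])-\rho(x)\psi(y)=0.$$
   Context: A linear kernel vector of a representation $(\rho,V)$ of a Lie algebra $\mathfrak{g}$ is a linear map $\psi:\mathfrak{g}\to V$, not identically zero, such that $\rho(x)\psi(x)=0$ for every $x\in\mathfrak{g}$. "The trivial representation is not a subrepresentation" means there is no nonzero $v\in V$ with $\rho(x)v=0$ for all $x\in\mathfrak{g}$. The adjoint representation is $\mathrm{ad}_x(y)=[x,y]$. *)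

theory Defs
  imports "HOL-Computational_Algebra.Polynomial"
begin

locale lie_algebra = vector_space scale
  for scale :: "'f::field \<Rightarrow> 'g::ab_group_add \<Rightarrow> 'g" +
  fixes bracket :: "'g \<Rightarrow> 'g \<Rightarrow> 'g"
  assumes bracket_linear_left: "Vector_Spaces.linear scale scale (\<lambda>x. bracket x y)"
    and bracket_linear_right: "Vector_Spaces.linear scale scale (\<lambda>y. bracket x y)"
    and bracket_self: "bracket x x = 0"
    and jacobi:
      "bracket x (bracket y z) + bracket y (bracket z x) + bracket z (bracket x y) = 0"
begin

text \<open>The next two notions are relative to a subspace \<open>I\<close> that is closed under the bracket,
  regarded as a Lie algebra in its own right; the whole algebra is \<open>I = UNIV\<close>.\<close>

definition lie_ideal :: "'g set \<Rightarrow> 'g set \<Rightarrow> bool" where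
  "lie_ideal J I \<longleftrightarrow> subspace J \<and> J \<subseteq> I \<and> (\<forall>x\<in>I. \<forall>y\<in>J. bracket x y \<in> J)"

definition simple_lie :: "'g set \<Rightarrow> bool" where
  "simple_lie I \<longleftrightarrow>
     subspace I \<and> (\<forall>x\<in>I. \<forall>y\<in>I. bracket x y \<in> I) \<and>
     (\<exists>x\<in>I. \<exists>y\<in>I. bracket x y \<noteq> 0) \<and>
     (\<forall>J. lie_ideal J I \<longrightarrow> J = {0} \<or> J = I)"

text \<open>Semisimple means: internal direct sum of simple (in particular non-abelian) ideals.
  In characteristic 0 and finite dimension this agrees with the vanishing of the solvable radical
  and with the nondegeneracy of the Killing form.  In positive characteristic the three conditions
  differ: nondegenerate Killing form implies direct sum of simple ideals, which (in finite
  dimension) implies zero radical, and the second converse fails for algebras such as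
  \<open>sl\<^sub>2 \<otimes> F[X,Y]/(X^p,Y^p)\<close> extended by derivations of the truncated polynomial ring.\<close>

definition semisimple :: bool where
  "semisimple \<longleftrightarrow>
     (\<exists>\<S>. (\<forall>I\<in>\<S>. lie_ideal I UNIV \<and> simple_lie I) \<and>
          span (\<Union>\<S>) = UNIV \<and>
          (\<forall>I\<in>\<S>. I \<inter> span (\<Union>(\<S> - {I})) = {0}))"

end

locale lie_representation =
  lie_algebra scaleG bracket + V: vector_space scaleV
  for scaleG :: "'f::field \<Rightarrow> 'g::ab_group_add \<Rightarrow> 'g"
    and bracket :: "'g \<Rightarrow> 'g \<Rightarrow> 'g"
    and scaleV :: "'f \<Rightarrow> 'v::ab_group_add \<Rightarrow> 'v" +
  fixes \<rho> :: "'g \<Rightarrow> 'v \<Rightarrow> 'v"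
  assumes rho_linear_left: "Vector_Spaces.linear scaleG scaleV (\<lambda>x. \<rho> x v)"
    and rho_linear_right: "Vector_Spaces.linear scaleV scaleV (\<rho> x)"
    and rho_bracket: "\<rho> (bracket x y) v = \<rho> x (\<rho> y v) - \<rho> y (\<rho> x v)"
begin

definition contains_trivial :: bool where
  "contains_trivial \<longleftrightarrow> (\<exists>v. v \<noteq> 0 \<and> (\<forall>x. \<rho> x v = 0))"

definition linear_kernel_vector :: "('g \<Rightarrow> 'v) \<Rightarrow> bool" where
  "linear_kernel_vector \<psi> \<longleftrightarrow>
     Vector_Spaces.linear scaleG scaleV \<psi> \<and> (\<exists>x. \<psi> x \<noteq> 0) \<and> (\<forall>x. \<rho> x (\<psi> x) = 0)"

end

definition representation_hom ::
  "('f::field \<Rightarrow> 'u::ab_group_add \<Rightarrow> 'u) \<Rightarrow> ('g \<Rightarrow> 'u \<Rightarrow> 'u) \<Rightarrow>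
   ('f \<Rightarrow> 'v::ab_group_add \<Rightarrow> 'v) \<Rightarrow> ('g \<Rightarrow> 'v \<Rightarrow> 'v) \<Rightarrow> ('u \<Rightarrow> 'v) \<Rightarrow> bool" where
  "representation_hom scaleU \<sigma> scaleV \<rho> \<psi> \<longleftrightarrow>
     Vector_Spaces.linear scaleU scaleV \<psi> \<and> (\<forall>x u. \<psi> (\<sigma> x u) = \<rho> x (\<psi> u))"

context lie_algebra
begin

definition ad :: "'g \<Rightarrow> 'g \<Rightarrow> 'g" where
  "ad x y = bracket x y"

lemma bracket_add_left: "bracket (x + y) z = bracket x z + bracket y z"
  using bracket_linear_left[of z] by (rule Vector_Spaces.linear.axioms(3)[THEN module_hom.add])

lemma bracket_add_right: "bracket z (x + y) = bracket z x + bracket z y"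
  using bracket_linear_right[of z] by (rule Vector_Spaces.linear.axioms(3)[THEN module_hom.add])

lemma bracket_antisym: "bracket x y = - bracket y x"
proof -
  have "0 = bracket (x + y) (x + y)"
    by (simp only: bracket_self)
  also have "\<dots> = bracket x y + bracket y x"
    by (simp only: bracket_add_left bracket_add_right) (simp add: bracket_self add.commute)
  finally show ?thesis
    by (simp add: eq_neg_iff_add_eq_0)
qed

lemma bracket_minus_right: "bracket z (- x) = - bracket z x"
  using bracket_add_right[of z x "- x"] bracket_add_right[of z 0 0]
  by (simp add: eq_neg_iff_add_eq_0 add.commute)

lemma ad_representation: "lie_representation scale bracket scale ad"
proof (intro lie_representation.intro lie_representation_axioms.intro)
  fix x y v
  have "bracket v (bracket x y) = - bracket (bracket x y) v"
    and "bracket y (bracket v x) = - bracket y (bracket x v)"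
    using bracket_antisym bracket_antisym[of v x] bracket_minus_right by metis+
  then show "ad (bracket x y) v = ad x (ad y v) - ad y (ad x v)"
    using jacobi[of x y v] unfolding ad_def by (simp add: algebra_simps)
next
  show "Vector_Spaces.linear scale scale (\<lambda>x. ad x v)" for v
    unfolding ad_def by (rule bracket_linear_left)
  show "Vector_Spaces.linear scale scale (ad x)" for x
    using bracket_linear_right[of x] by (simp add: ad_def[abs_def])
qed (rule lie_algebra_axioms vector_space_axioms)+

end

end

theory Submission
  imports Defs
begin

text \<open>Let \<open>\<phi>(x,y) = \<psi>[x,y] - x \<psi>(y)\<close>.  Polarising \<open>x \<psi>(x) = 0\<close> expresses \<open>2 x y \<psi>(z)\<close> through
  terms \<open>[a,b] \<psi>(c)\<close>, which shows that \<open>\<Phi>(z,x,y) = z \<phi>(x,y)\<close> is alternating.  Hence each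
  \<open>\<phi>(\<cdot>,y)\<close> is again annihilated in the same way, and applying the same formula to it gives
  \<open>\<Phi>([x,y],z,w) = - \<Phi>([z,w],x,y)\<close>.  An alternating trilinear map with this exchange property
  vanishes on brackets, because moving two successive brackets across reverses their order.  A
  semisimple algebra is spanned by brackets, so \<open>\<phi>(x,y)\<close> is annihilated by the whole algebra.\<close>

section \<open>Brackets, the exchange argument and perfectness\<close>

context lie_algebra
begin

text \<open>The Jacobi identity in the form that unfolds the block \<open>bracket y z\<close> into
  successive right brackets by \<open>y\<close> and \<open>z\<close>.\<close>

lemma bracket_bracket: "bracket x (bracket y z) = bracket (bracket x y) z - bracket (bracket x z) y"
proof -
  have "bracket (bracket x y) z = - bracket z (bracket x y)"
    by (rule bracket_antisym)
  moreover have "bracket (bracket x z) y = bracket y (bracket z x)"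
    using bracket_antisym[of "bracket x z" y] bracket_antisym[of x z]
    by (simp add: bracket_minus_right)
  moreover have "bracket x (bracket y z) = - (bracket y (bracket z x) + bracket z (bracket x y))"
    using jacobi[of x y z] by (simp only: eq_neg_iff_add_eq_0 add.assoc)
  ultimately show ?thesis
    by simp
qed

lemma jacobi_left: "bracket (bracket x y) z + bracket (bracket y z) x + bracket (bracket z x) y = 0"
proof -
  have "- bracket (bracket y z) x - bracket (bracket z x) y - bracket (bracket x y) z = 0"
    using jacobi[of x y z] bracket_antisym[of x "bracket y z"] bracket_antisym[of y "bracket z x"]
      bracket_antisym[of z "bracket x y"]
    by simp
  then show ?thesis
    by (simp add: algebra_simps neg_eq_iff_add_eq_0 eq_neg_iff_add_eq_0)
qed

text \<open>Moving \<open>bracket e f\<close> across as one block costs a sign. Moving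
  \<open>e\<close> and \<open>f\<close> across one after the other also reverses their order, which
  costs a second sign. The two results are opposite, so both vanish.\<close>

lemma alternating_exchange_vanishes:
  fixes \<Phi> :: "'g \<Rightarrow> 'g \<Rightarrow> 'g \<Rightarrow> 'v::ab_group_add"
  assumes diff: "\<And>x x' y z. \<Phi> (x - x') y z = \<Phi> x y z - \<Phi> x' y z"
    and swap12: "\<And>x y z. \<Phi> x y z = - \<Phi> y x z"
    and exchange: "\<And>x y z w. \<Phi> (bracket x y) z w = - \<Phi> (bracket z w) x y"
    and two: "\<And>v::'v. v + v = 0 \<Longrightarrow> v = 0"
  shows "\<Phi> (bracket a b) (bracket c d) (bracket e f) = 0"
proof -
  have move: "\<Phi> (bracket (bracket x y) z) a b = - \<Phi> (bracket (bracket a b) z) x y" for x y z a b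
  proof -
    have "\<Phi> (bracket (bracket x y) z) a b = - \<Phi> (bracket a b) (bracket x y) z"
      by (rule exchange)
    also have "\<dots> = \<Phi> (bracket x y) (bracket a b) z"
      using swap12[of "bracket a b" "bracket x y" z] by simp
    also have "\<dots> = - \<Phi> (bracket (bracket a b) z) x y"
      by (rule exchange)
    finally show ?thesis .
  qed
  have move2: "\<Phi> (bracket (bracket (bracket c d) e) f) a b
      = - \<Phi> (bracket (bracket (bracket a b) f) e) c d" for a b c d e f
  proof -
    have "\<Phi> (bracket (bracket (bracket c d) e) f) a b
        = - \<Phi> (bracket (bracket a b) f) (bracket c d) e"
      by (rule move)
    also have "\<dots> = \<Phi> (bracket c d) (bracket (bracket a b) f) e"
      using swap12[of "bracket (bracket a b) f" "bracket c d" e] by simp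
    also have "\<dots> = - \<Phi> (bracket (bracket (bracket a b) f) e) c d"
      by (rule exchange)
    finally show ?thesis .
  qed
  \<comment> \<open>By \<open>exchange\<close>, \<open>X\<close> is the negative of the value in the
    goal.\<close>
  define X where "X = \<Phi> (bracket (bracket c d) (bracket e f)) a b"
  have "X = - \<Phi> (bracket (bracket a b) (bracket e f)) c d"
    unfolding X_def by (rule move)
  moreover have "X = \<Phi> (bracket (bracket a b) (bracket e f)) c d"
    unfolding X_def
    by (simp add: bracket_bracket[of "bracket c d"] bracket_bracket[of "bracket a b"] diff
        move2[of c d e f a b] move2[of c d f e a b])
  ultimately have "X = 0"
    using two[of X] by (metis add.right_inverse)
  then show ?thesis
    using exchange[of a b "bracket c d" "bracket e f"] unfolding X_def by simp
qed

text \<open>The span of brackets meets \<open>I\<close> in an ideal of \<open>I\<close>, nonzero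
  because \<open>I\<close> is not abelian; simplicity forces it to be all of
  \<open>I\<close>.\<close>

lemma simple_lie_subset_span_brackets:
  assumes I: "simple_lie I"
  shows "I \<subseteq> span {bracket x y |x y. True}"
proof -
  let ?D = "span {bracket x y |x y. True}"
  have br: "bracket x y \<in> ?D" for x y
    by (rule span_base) blast
  have "lie_ideal (I \<inter> ?D) I"
    using I br unfolding lie_ideal_def simple_lie_def
    by (auto intro: subspace_inter subspace_span)
  moreover have "I \<inter> ?D \<noteq> {0}"
    using I br unfolding simple_lie_def by blast
  ultimately show ?thesis
    using I unfolding simple_lie_def by blast
qed

text \<open>Perfectness lets an identity checked on brackets extend to the whole algebra by
  linearity.\<close>

lemma semisimple_span_brackets:
  assumes "semisimple"
  shows "span {bracket x y |x y. True} = UNIV"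
proof -
  obtain \<S> where S: "\<forall>I\<in>\<S>. lie_ideal I UNIV \<and> simple_lie I" and U: "span (\<Union>\<S>) = UNIV"
    using assms unfolding semisimple_def by (elim exE conjE) rule
  have "\<Union>\<S> \<subseteq> span {bracket x y |x y. True}"
    using S simple_lie_subset_span_brackets by (intro Union_least) simp
  then have "span (\<Union>\<S>) \<subseteq> span {bracket x y |x y. True}"
    by (rule span_minimal[OF _ subspace_span])
  then show ?thesis
    using U by auto
qed

end

section \<open>Kernel maps and their second-order identity\<close>

context lie_representation
begin

lemma rho_diff_left: "\<rho> (x - y) v = \<rho> x v - \<rho> y v"
  using rho_linear_left[of v] by (rule Vector_Spaces.linear.axioms(3)[THEN module_hom.diff])

lemma rho_add_left: "\<rho> (x + y) v = \<rho> x v + \<rho> y v"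
  using rho_linear_left[of v] by (rule Vector_Spaces.linear.axioms(3)[THEN module_hom.add])

lemma rho_neg_left: "\<rho> (- x) v = - \<rho> x v"
  using rho_linear_left[of v] by (rule Vector_Spaces.linear.axioms(3)[THEN module_hom.neg])

lemma rho_zero_right: "\<rho> x 0 = 0"
  using rho_linear_right[of x] by (rule Vector_Spaces.linear.axioms(3)[THEN module_hom.zero])

lemma rho_add_right: "\<rho> x (v + w) = \<rho> x v + \<rho> x w"
  using rho_linear_right[of x] by (rule Vector_Spaces.linear.axioms(3)[THEN module_hom.add])

lemma rho_diff_right: "\<rho> x (v - w) = \<rho> x v - \<rho> x w"
  using rho_linear_right[of x] by (rule Vector_Spaces.linear.axioms(3)[THEN module_hom.diff])

lemma rho_neg_right: "\<rho> x (- v) = - \<rho> x v"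
  using rho_linear_right[of x] by (rule Vector_Spaces.linear.axioms(3)[THEN module_hom.neg])

definition kernel_map :: "('g \<Rightarrow> 'v) \<Rightarrow> bool" where
  "kernel_map \<psi> \<longleftrightarrow> (\<forall>x y. \<psi> (x + y) = \<psi> x + \<psi> y) \<and> (\<forall>x. \<rho> x (\<psi> x) = 0)"

definition defect :: "('g \<Rightarrow> 'v) \<Rightarrow> 'g \<Rightarrow> 'g \<Rightarrow> 'v" where
  "defect \<psi> x y = \<psi> (bracket x y) - \<rho> x (\<psi> y)"

lemma kernel_map_add: "kernel_map \<psi> \<Longrightarrow> \<psi> (x + y) = \<psi> x + \<psi> y"
  by (simp add: kernel_map_def)

lemma kernel_map_zero: "kernel_map \<psi> \<Longrightarrow> \<psi> 0 = 0"
  using kernel_map_add[of \<psi> 0 0] by simp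

lemma kernel_map_neg: "kernel_map \<psi> \<Longrightarrow> \<psi> (- x) = - \<psi> x"
  using kernel_map_add[of \<psi> x "- x"] kernel_map_zero[of \<psi>]
  by (simp add: eq_neg_iff_add_eq_0 add.commute)

lemma kernel_map_polar:
  assumes "kernel_map \<psi>"
  shows "\<rho> x (\<psi> y) = - \<rho> y (\<psi> x)"
proof -
  have "\<rho> (x + y) (\<psi> (x + y)) = 0" "\<rho> x (\<psi> x) = 0" "\<rho> y (\<psi> y) = 0"
    using assms unfolding kernel_map_def by blast+
  then show ?thesis
    by (simp add: kernel_map_add[OF assms] rho_add_left rho_add_right eq_neg_iff_add_eq_0
        add.commute)
qed

text \<open>Swapping the last two letters of \<open>\<rho> x (\<rho> y (\<psi> z))\<close> flips the
  sign, and swapping the first two costs a bracket term. Alternating three swaps of each kind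
  returns to the same word with sign -1, so its double is a sum of bracket terms.\<close>

lemma kernel_map_second_order:
  assumes "kernel_map \<psi>"
  shows "\<rho> x (\<rho> y (\<psi> z)) + \<rho> x (\<rho> y (\<psi> z))
    = \<rho> (bracket z y) (\<psi> x) + \<rho> (bracket z x) (\<psi> y) + \<rho> (bracket x y) (\<psi> z)"
proof -
  have "\<rho> u (\<rho> v (\<psi> w)) = - \<rho> u (\<rho> w (\<psi> v))" for u v w
    using kernel_map_polar[OF assms, of v w] by (simp add: rho_neg_right)
  from this[of z y x] this[of x z y] this[of y z x] show ?thesis
    by (simp add: rho_bracket algebra_simps)
qed

section \<open>Symmetries of the defect and its vanishing\<close>

lemma defect_antisym:
  assumes "kernel_map \<psi>"
  shows "defect \<psi> x y = - defect \<psi> y x"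
  unfolding defect_def
  using kernel_map_polar[OF assms, of x y] bracket_antisym[of x y]
  by (simp add: kernel_map_neg[OF assms])

text \<open>The \<open>\<psi>\<close> terms of the cyclic sum cancel by Jacobi; what remains is
  matched with the right side by \<open>kernel_map_second_order\<close>.\<close>

lemma defect_cyclic:
  assumes "kernel_map \<psi>"
  shows "defect \<psi> (bracket x y) z + defect \<psi> (bracket y z) x + defect \<psi> (bracket z x) y
    = \<rho> z (defect \<psi> x y) + \<rho> z (defect \<psi> x y)"
proof -
  have "\<psi> (bracket (bracket x y) z + bracket (bracket y z) x + bracket (bracket z x) y) = 0"
    by (simp only: jacobi_left kernel_map_zero[OF assms])
  then have jac: "\<psi> (bracket (bracket x y) z) + \<psi> (bracket (bracket y z) x)
      + \<psi> (bracket (bracket z x) y) = 0"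
    by (simp only: kernel_map_add[OF assms])
  have polar: "\<rho> z (\<psi> (bracket x y)) = - \<rho> (bracket x y) (\<psi> z)"
    by (rule kernel_map_polar[OF assms])
  have "\<rho> (bracket y x) (\<psi> z) = - \<rho> (bracket x y) (\<psi> z)"
    using bracket_antisym[of y x] by (simp add: rho_neg_left)
  then have second: "\<rho> z (\<rho> x (\<psi> y)) + \<rho> z (\<rho> x (\<psi> y))
      = \<rho> (bracket y x) (\<psi> z) + \<rho> (bracket y z) (\<psi> x) + \<rho> (bracket z x) (\<psi> y)"
    using kernel_map_second_order[OF assms, of z x y] by simp
  have "\<rho> z (defect \<psi> x y) + \<rho> z (defect \<psi> x y)
      = - (\<rho> (bracket x y) (\<psi> z) + \<rho> (bracket x y) (\<psi> z))
        - (\<rho> z (\<rho> x (\<psi> y)) + \<rho> z (\<rho> x (\<psi> y)))"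
    by (simp add: defect_def rho_diff_right polar)
  also have "\<dots> = - (\<rho> (bracket x y) (\<psi> z) + \<rho> (bracket y z) (\<psi> x) + \<rho> (bracket z x) (\<psi> y))"
    unfolding second using bracket_antisym[of y x] by (simp add: rho_neg_left)
  also have "\<dots> = defect \<psi> (bracket x y) z + defect \<psi> (bracket y z) x + defect \<psi> (bracket z x) y"
    using jac by (simp add: defect_def algebra_simps)
  finally show ?thesis
    by simp
qed

lemma kernel_map_defect:
  assumes "kernel_map \<psi>"
  shows "kernel_map (\<lambda>x. defect \<psi> x y)"
proof -
  have "\<rho> x (defect \<psi> x y) = 0" for x
  proof -
    have "\<rho> x (\<rho> x (\<psi> y)) = - \<rho> x (\<rho> y (\<psi> x))"
      using kernel_map_polar[OF assms, of x y] by (simp add: rho_neg_right)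
    also have "\<dots> = - \<rho> (bracket x y) (\<psi> x)"
      using assms by (simp add: rho_bracket rho_zero_right kernel_map_def)
    also have "\<dots> = \<rho> x (\<psi> (bracket x y))"
      using kernel_map_polar[OF assms, of x "bracket x y"] by simp
    finally show ?thesis
      by (simp add: defect_def rho_diff_right)
  qed
  then show ?thesis
    unfolding kernel_map_def
    by (simp add: defect_def bracket_add_left kernel_map_add[OF assms] rho_add_left)
qed

text \<open>Polarising \<open>kernel_map_defect\<close> gives the first transposition, antisymmetry
  of \<open>defect\<close> the second; together they generate all permutations of the three
  arguments.\<close>

lemma rho_defect_swap:
  assumes "kernel_map \<psi>"
  shows "\<rho> x (defect \<psi> y z) = - \<rho> y (defect \<psi> x z)"
    and "\<rho> x (defect \<psi> y z) = - \<rho> x (defect \<psi> z y)"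
proof -
  show "\<rho> x (defect \<psi> y z) = - \<rho> y (defect \<psi> x z)"
    by (rule kernel_map_polar[OF kernel_map_defect[OF assms]])
  show "\<rho> x (defect \<psi> y z) = - \<rho> x (defect \<psi> z y)"
    using defect_antisym[OF assms, of y z] by (simp add: rho_neg_right)
qed

lemma rho_defect_exchange:
  assumes ker: "kernel_map \<psi>" and two: "\<And>v::'v. v + v = 0 \<Longrightarrow> v = 0"
  shows "\<rho> (bracket x y) (defect \<psi> z w) = - \<rho> (bracket z w) (defect \<psi> x y)"
proof -
  define F where "F a b c d = \<rho> (bracket a b) (defect \<psi> c d)" for a b c d
  have F1: "F a b c d = - F b a c d" for a b c d
    using bracket_antisym[of a b] by (simp add: F_def rho_neg_left)
  have F2: "F a b c d = - F a b d c" for a b c d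
    unfolding F_def by (rule rho_defect_swap(2)[OF ker])
  have second: "\<rho> x (\<rho> y (defect \<psi> z w)) + \<rho> x (\<rho> y (defect \<psi> z w))
      = F z y x w + F z x y w + F x y z w" for x y z w
    unfolding F_def by (rule kernel_map_second_order[OF kernel_map_defect[OF ker]])
  have neg: "\<rho> x (\<rho> y (defect \<psi> w z)) = - \<rho> x (\<rho> y (defect \<psi> z w))" for x y z w
    using defect_antisym[OF ker, of w z] by (simp add: rho_neg_right)
  \<comment> \<open>\<open>Q\<close> symmetrises \<open>F\<close> under exchange of the two pairs;
    the claim is that it vanishes.\<close>
  define Q where "Q a b c d = F a b c d + F c d a b" for a b c d
  have Q1: "Q a b c d = - Q b a c d" for a b c d
    unfolding Q_def using F1[of a b c d] F2[of c d a b] by simp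
  \<comment> \<open>Adding \<open>second\<close> to its copy with \<open>z\<close> and
    \<open>w\<close> interchanged makes the left sides cancel, as \<open>defect\<close> is
    antisymmetric.\<close>
  have A: "Q x z y w = - Q x w y z" for x y z w
  proof -
    have "(F z y x w + F z x y w + F x y z w) + (F w y x z + F w x y z + F x y w z) = 0"
      unfolding second[symmetric] neg[of x y w z] by simp
    then show ?thesis
      unfolding Q_def F2[of x y w z] F1[of z y x w] F1[of z x y w] F1[of w y x z] F1[of w x y z]
      by (simp add: algebra_simps eq_neg_iff_add_eq_0 neg_eq_iff_add_eq_0)
  qed
  \<comment> \<open>\<open>\<rho> u\<close> is applied to \<open>defect_cyclic\<close>:
    \<open>R\<close> rewrites the cyclic sum in terms of \<open>F\<close>, and \<open>second\<close>
    does so for the other side.\<close>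
  have B: "Q x y u z = - Q y z u x" for x y z u
  proof -
    have R: "\<rho> u (defect \<psi> (bracket a b) c) = - F a b u c" for a b c
      unfolding F_def by (rule rho_defect_swap(1)[OF ker])
    have "\<rho> u (defect \<psi> (bracket x y) z + defect \<psi> (bracket y z) x + defect \<psi> (bracket z x) y)
        = \<rho> u (\<rho> z (defect \<psi> x y)) + \<rho> u (\<rho> z (defect \<psi> x y))"
      unfolding defect_cyclic[OF ker] by (rule rho_add_right)
    then have "- F x y u z - F y z u x - F z x u y = F x z u y + F x u z y + F u z x y"
      by (simp add: rho_add_right R second)
    then have "F x y u z + F y z u x + (F x u z y + F u z x y) = 0"
      unfolding F1[of z x u y] by (simp add: algebra_simps eq_neg_iff_add_eq_0)
    then show ?thesis
      unfolding Q_def using F1[of x u z y] F2[of u x z y]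
      by (simp add: algebra_simps eq_neg_iff_add_eq_0)
  qed
  \<comment> \<open>\<open>B\<close>, \<open>A\<close> and \<open>Q1\<close> in turn lead back to
    the original order of arguments after three sign changes.\<close>
  have "Q x y z w = - Q x y z w"
    using B[of x y z w] A[of y w z x] Q1[of y x z w] by simp
  then have "Q x y z w = 0"
    using two[of "Q x y z w"] by (metis add.right_inverse)
  then show ?thesis
    unfolding Q_def F_def by (simp add: eq_neg_iff_add_eq_0)
qed

lemma defect_eq_zero:
  assumes ker: "kernel_map \<psi>" and two: "\<And>v::'v. v + v = 0 \<Longrightarrow> v = 0"
    and perfect: "span {bracket x y |x y. True} = UNIV"
    and nontriv: "\<not> contains_trivial"
  shows "defect \<psi> x y = 0"
proof -
  define \<Phi> where "\<Phi> x y z = \<rho> x (defect \<psi> y z)" for x y z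
  have brackets: "\<Phi> (bracket a b) (bracket c d) (bracket e f) = 0" for a b c d e f
    unfolding \<Phi>_def
    by (rule alternating_exchange_vanishes[OF rho_diff_left rho_defect_swap(1)[OF ker]
          rho_defect_exchange[OF ker two] two])
  \<comment> \<open>Linearity is applied in the first slot only; the steps below use transpositions
    to bring each argument there in turn.\<close>
  have induct: "\<Phi> x y z = 0" if "\<And>a b. \<Phi> (bracket a b) y z = 0" for x y z
  proof -
    have "\<rho> (scaleG c x) v = scaleV c (\<rho> x v)" for c x v
      using rho_linear_left[of v] by (rule Vector_Spaces.linear.axioms(3)[THEN module_hom.scale])
    moreover have "\<rho> 0 v = 0" for v
      using rho_diff_left[of 0 0 v] by simp
    ultimately have "subspace {x. \<Phi> x y z = 0}"
      unfolding \<Phi>_def by (intro subspaceI) (simp_all add: rho_add_left)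
    moreover have "{bracket x y |x y. True} \<subseteq> {x. \<Phi> x y z = 0}"
      using that by auto
    ultimately have "span {bracket x y |x y. True} \<subseteq> {x. \<Phi> x y z = 0}"
      by (intro span_minimal)
    then show ?thesis
      using perfect by auto
  qed
  have swap12: "\<Phi> x y z = - \<Phi> y x z" and swap23: "\<Phi> x y z = - \<Phi> x z y" for x y z
    unfolding \<Phi>_def by (rule rho_defect_swap[OF ker])+
  have "\<Phi> x (bracket c d) (bracket e f) = 0" for x c d e f
    by (rule induct) (rule brackets)
  then have "\<Phi> (bracket a b) y (bracket e f) = 0" for a b y e f
    using swap12[of "bracket a b" y] by simp
  then have "\<Phi> x y (bracket e f) = 0" for x y e f
    by (rule induct)
  then have "\<Phi> (bracket a b) y z = 0" for a b y z
    using swap12[of "bracket a b" y z] swap23[of y "bracket a b" z] by simp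
  then have "\<Phi> z x y = 0" for x y z
    by (rule induct)
  \<comment> \<open>Every \<open>z\<close> annihilates \<open>defect \<psi> x y\<close>, so a
    nonzero value would span a trivial subrepresentation.\<close>
  then show ?thesis
    using nontriv unfolding \<Phi>_def contains_trivial_def by blast
qed

end

theorem theorem5p1:
  fixes scaleG :: "'f::alg_closed_field \<Rightarrow> 'g::ab_group_add \<Rightarrow> 'g"
    and bracket :: "'g \<Rightarrow> 'g \<Rightarrow> 'g"
    and scaleV :: "'f \<Rightarrow> 'v::ab_group_add \<Rightarrow> 'v"
    and \<rho> :: "'g \<Rightarrow> 'v \<Rightarrow> 'v"
    and \<psi> :: "'g \<Rightarrow> 'v"
  assumes "CHAR('f) \<noteq> 2" and "CHAR('f) \<noteq> 3"
    and "lie_algebra scaleG bracket"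
    and "lie_algebra.semisimple scaleG bracket"
    and "lie_representation scaleG bracket scaleV \<rho>"
    and "\<exists>B. finite_dimensional_vector_space scaleV B"
    and "\<not> lie_representation.contains_trivial \<rho>"
    and "lie_representation.linear_kernel_vector scaleG scaleV \<rho> \<psi>"
  shows "representation_hom scaleG (lie_algebra.ad bracket) scaleV \<rho> \<psi>
    \<and> (\<forall>x y. \<psi> (bracket x y) - \<rho> x (\<psi> y) = 0)"
proof -
  interpret lie_representation scaleG bracket scaleV \<rho> by fact
  have lin: "Vector_Spaces.linear scaleG scaleV \<psi>" and zero: "\<rho> x (\<psi> x) = 0" for x
    using assms(8) unfolding linear_kernel_vector_def by simp_all
  have ker: "kernel_map \<psi>"
    unfolding kernel_map_def
    using lin[THEN Vector_Spaces.linear.axioms(3), THEN module_hom.add] zero by simp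
  \<comment> \<open>A divisor of the prime 2 is 1 or 2, and no field has characteristic 1.\<close>
  have "\<not> CHAR('f) dvd 2"
    using assms(1) CHAR_not_1[where ?'a = 'f] two_is_prime_nat
    by (metis One_nat_def prime_nat_iff)
  then have nz: "(2::'f) \<noteq> 0"
    using of_nat_eq_0_iff_char_dvd[where ?'a = 'f, of 2] by simp
  have two: "v = 0" if "v + v = 0" for v :: 'v
  proof -
    have "scaleV 2 v = v + v"
      by (metis V.scale_left_distrib V.scale_one one_add_one)
    with that nz show ?thesis
      by simp
  qed
  have "defect \<psi> x y = 0" for x y
    using ker two semisimple_span_brackets[OF assms(4)] assms(7) by (rule defect_eq_zero)
  then show ?thesis
    using lin by (simp add: representation_hom_def defect_def ad_def)
qed

end
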